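(* Let $\alpha\in(0,1)$ and let $U=(U_1,U_2)\colon\mathbb R^{\mathbb R^d}\times\mathbb R^d\times\mathbb R^d\to\mathbb R^2$ be defined for $v\colon\mathbb R^d\to\mathbb R$ and $k,y\in\mathbb R^d$ by $$U_1(v,k,y)=\alpha-\mathbf 1\{\Lambda(y+k)\le-v(k)\},$$ $$U_2(v,k,y)=\tfrac1\alpha\mathbf 1\{\Lambda(y+k)\le-v(k)\}\Lambda(y+k)+\tfrac1\alpha\big(\mathbf 1\{\Lambda(y+k)\le-v(k)\}-\alpha\big)v(k).$$ For any $F\in\mathcal M^d$, the component $U_2$ is oriented in the sense that for any $k\in\mathbb R^d$ $$\bar U_2(T^{\mathrm{VaR}_\alpha}(F),k,F)\begin{cases}<0,&\text{if }k\notin R^{ES_\alpha}(F)\\ =0,&\text{if }k\in R_0^{ES_\alpha}(F)\\ >0,&\text{if }k\in R^{ES_\alpha}(F)\setminus R_0^{ES_\alpha}(F).\end{cases}$$ If all distribution functions in $\mathcal M$ are continuous and strictly increasing, then $U$ is a selective $\mathcal M^d$-identification function for $(T^{\mathrm{VaR}_\alpha},R_0^{ES_\alpha})\colon\mathcal M^d\to\mathbb R^{\mathbb R^d}\times2^{\mathbb R^d}$, i.e. $\bar U(T^{\mathrm{VaR}_\alpha}(F),k,F)=0$ for all $F\in\mathcal M^d$ and all $k\in R_0^{ES_\alpha}(F)$.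
   Context: Setting: $(\Omega,\mathfrak F,\mathbb P)$ is an atomless probability space, $d\ge1$, $\mathcal Y^d\subseteq L^0(\Omega;\mathbb R^d)$ is a class of random vectors closed under translation by constants. $\Lambda\colon\mathbb R^d\to\mathbb R$ is non-decreasing for the componentwise order (an aggregation function). $\mathcal Y\subseteq L^0(\Omega;\mathbb R)$ contains $\Lambda(Y)$ for all $Y\in\mathcal Y^d$ (hence $\Lambda(Y+k)\in\mathcal Y$ for all $k\in\mathbb R^d$). $\mathcal M^d$ and $\mathcal M$ are the classes of distributions of elements of $\mathcal Y^d$ and $\mathcal Y$. For a distribution function $F$ on $\mathbb R$: $\mathrm{VaR}_\alpha(F)=-\inf\{x\in\mathbb R:\alpha\le F(x)\}$ and $$ES_\alpha(F)=\frac1\alpha\int_0^\alpha\mathrm{VaR}_\beta(F)\,d\beta=-\frac1\alpha\int_{(-\infty,-\mathrm{VaR}_\alpha(F)]}x\,dF(x)-\frac1\alpha\mathrm{VaR}_\alpha(F)\big(F(-\mathrm{VaR}_\alpha(F))-\alpha\big).$$ For a random variable $X$ with distribution $F$, $\mathrm{VaR}_\alpha(X)=\mathrm{VaR}_\alpha(F)$ and $ES_\alpha(X)=ES_\alpha(F)$. $ES_\alpha$ is assumed real-valued on $\mathcal M$. For $Y\in\mathcal Y^d$ with distribution $F$: $R^{ES_\alpha}(F)=R^{ES_\alpha}(Y)=\{k\in\mathbb R^d: ES_\alpha(\Lambda(Y+k))\le0\}$, $R_0^{ES_\alpha}(F)=\{k\in\mathbb R^d: ES_\alpha(\Lambda(Y+k))=0\}$,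 and $T^{\mathrm{VaR}_\alpha}(F)=T^{\mathrm{VaR}_\alpha}(Y)\colon\mathbb R^d\to\mathbb R$, $k\mapsto\mathrm{VaR}_\alpha(\Lambda(Y+k))$. $\mathbb R^{\mathbb R^d}$ is the set of functions $\mathbb R^d\to\mathbb R$. Bars denote expectation: $\bar U(v,k,F)=\int U(v,k,y)\,dF(y)$ (componentwise). *)

theory Defs
  imports "HOL-Probability.Probability"
begin

definition atomless :: "'w measure \<Rightarrow> bool" where
  "atomless M \<longleftrightarrow>
     (\<forall>A\<in>sets M. emeasure M A > 0 \<longrightarrow>
        (\<exists>B\<in>sets M. B \<subseteq> A \<and> 0 < emeasure M B \<and> emeasure M B < emeasure M A))"

definition laws :: "'w measure \<Rightarrow> ('w \<Rightarrow> 'b::topological_space) set \<Rightarrow> 'b measure set" where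
  "laws M \<Y> = (\<lambda>Y. distr M borel Y) ` \<Y>"


text \<open>A distribution on the line is represented by its law; its distribution function is \<^const>\<open>cdf\<close>.\<close>

definition VaR :: "real \<Rightarrow> real measure \<Rightarrow> real" where
  "VaR \<alpha> \<mu> = - Inf {x. \<alpha> \<le> cdf \<mu> x}"

definition ES :: "real \<Rightarrow> real measure \<Rightarrow> real" where
  "ES \<alpha> \<mu> = (1 / \<alpha>) * (LBINT \<beta>=ereal 0..ereal \<alpha>. VaR \<beta> \<mu>)"

text \<open>For \<open>\<alpha> \<in> (0,1)\<close> the function \<open>\<beta> \<mapsto> VaR \<beta> \<mu>\<close> is bounded below on \<open>(0,\<alpha>)\<close>, so its integral always
  exists in \<open>(-\<infinity>, \<infinity>]\<close>, and it is a real number exactly if the function is integrable.\<close>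

definition ES_real_valued :: "real \<Rightarrow> real measure \<Rightarrow> bool" where
  "ES_real_valued \<alpha> \<mu> \<longleftrightarrow> interval_lebesgue_integrable lborel (ereal 0) (ereal \<alpha>) (\<lambda>\<beta>. VaR \<beta> \<mu>)"


text \<open>A componentwise non-decreasing \<open>\<Lambda>\<close> on \<open>\<real>\<^sup>d\<close> need not be Borel measurable if \<open>d \<ge> 2\<close>. Integrals
  with respect to a law \<open>F\<close> on \<open>\<real>\<^sup>d\<close> are therefore taken with respect to the completion of \<open>F\<close>; for
  Borel measurable integrands this makes no difference (\<open>integral_completion\<close>).\<close>

definition agg_law :: "(real^'d \<Rightarrow> real) \<Rightarrow> real^'d \<Rightarrow> (real^'d) measure \<Rightarrow> real measure" where
  "agg_law \<Lambda> k F = distr (completion F) borel (\<lambda>y. \<Lambda> (y + k))"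

text \<open>If \<open>Y\<close> has law \<open>F\<close>, then \<open>agg_law \<Lambda> k F\<close> is the law of \<open>\<Lambda> (Y + k)\<close>.\<close>

lemma agg_law_distr:
  fixes Y :: "'w \<Rightarrow> real^'d"
  assumes Y: "Y \<in> borel_measurable M"
    and \<Lambda>: "(\<lambda>y. \<Lambda> (y + k)) \<in> borel_measurable (completion (distr M borel Y))"
    and \<Lambda>Y: "(\<lambda>\<omega>. \<Lambda> (Y \<omega> + k)) \<in> borel_measurable M"
  shows "agg_law \<Lambda> k (distr M borel Y) = distr M borel (\<lambda>\<omega>. \<Lambda> (Y \<omega> + k))"
proof -
  let ?N = "distr M borel Y"
  obtain g where g: "g \<in> borel_measurable ?N" and eq: "AE y in ?N. \<Lambda> (y + k) = g y"
    using completion_ex_borel_measurable_real[OF \<Lambda>] by blast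
  have gb: "g \<in> borel_measurable borel" using g by simp
  have "agg_law \<Lambda> k ?N = distr (completion ?N) borel g"
    unfolding agg_law_def
    using eq g \<Lambda> by (intro distr_cong_AE) (auto intro: AE_completion measurable_completion)
  also have "\<dots> = distr ?N borel g"
    using g by (rule distr_completion)
  also have "\<dots> = distr M borel (g \<circ> Y)"
    using gb Y by (rule distr_distr)
  also have "\<dots> = distr M borel (\<lambda>\<omega>. \<Lambda> (Y \<omega> + k))"
  proof (intro distr_cong_AE)
    show "AE \<omega> in M. (g \<circ> Y) \<omega> = \<Lambda> (Y \<omega> + k)"
      using AE_distrD[OF Y eq] by (auto elim: eventually_mono)
    show "g \<circ> Y \<in> borel_measurable M"
      using measurable_comp[OF Y gb] .
  qed (use \<Lambda>Y in auto)
  finally show ?thesis .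
qed

definition R_ES :: "real \<Rightarrow> (real^'d \<Rightarrow> real) \<Rightarrow> (real^'d) measure \<Rightarrow> (real^'d) set" where
  "R_ES \<alpha> \<Lambda> F = {k. ES \<alpha> (agg_law \<Lambda> k F) \<le> 0}"

definition R0_ES :: "real \<Rightarrow> (real^'d \<Rightarrow> real) \<Rightarrow> (real^'d) measure \<Rightarrow> (real^'d) set" where
  "R0_ES \<alpha> \<Lambda> F = {k. ES \<alpha> (agg_law \<Lambda> k F) = 0}"

definition T_VaR :: "real \<Rightarrow> (real^'d \<Rightarrow> real) \<Rightarrow> (real^'d) measure \<Rightarrow> real^'d \<Rightarrow> real" where
  "T_VaR \<alpha> \<Lambda> F = (\<lambda>k. VaR \<alpha> (agg_law \<Lambda> k F))"


definition U1 ::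
  "real \<Rightarrow> (real^'d \<Rightarrow> real) \<Rightarrow> (real^'d \<Rightarrow> real) \<Rightarrow> real^'d \<Rightarrow> real^'d \<Rightarrow> real" where
  "U1 \<alpha> \<Lambda> v k y = \<alpha> - of_bool (\<Lambda> (y + k) \<le> - v k)"

definition U2 ::
  "real \<Rightarrow> (real^'d \<Rightarrow> real) \<Rightarrow> (real^'d \<Rightarrow> real) \<Rightarrow> real^'d \<Rightarrow> real^'d \<Rightarrow> real" where
  "U2 \<alpha> \<Lambda> v k y =
     1 / \<alpha> * of_bool (\<Lambda> (y + k) \<le> - v k) * \<Lambda> (y + k)
     + 1 / \<alpha> * (of_bool (\<Lambda> (y + k) \<le> - v k) - \<alpha>) * v k"

definition U ::
  "real \<Rightarrow> (real^'d \<Rightarrow> real) \<Rightarrow> (real^'d \<Rightarrow> real) \<Rightarrow> real^'d \<Rightarrow> real^'d \<Rightarrow> real \<times> real" where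
  "U \<alpha> \<Lambda> v k y = (U1 \<alpha> \<Lambda> v k y, U2 \<alpha> \<Lambda> v k y)"

definition integrable_score ::
  "((real^'d \<Rightarrow> real) \<Rightarrow> real^'d \<Rightarrow> real^'d \<Rightarrow> 'b::{banach, second_countable_topology})
    \<Rightarrow> (real^'d) measure \<Rightarrow> bool" where
  "integrable_score V F \<longleftrightarrow> (\<forall>v k. integrable (completion F) (V v k))"

definition bar ::
  "((real^'d \<Rightarrow> real) \<Rightarrow> real^'d \<Rightarrow> real^'d \<Rightarrow> 'b::{banach, second_countable_topology})
    \<Rightarrow> (real^'d \<Rightarrow> real) \<Rightarrow> real^'d \<Rightarrow> (real^'d) measure \<Rightarrow> 'b" where
  "bar V v k F = (\<integral>y. V v k y \<partial>completion F)"

text \<open>Integrability is required explicitly, because \<open>bar\<close> is \<open>0\<close> by convention where the integral does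
  not exist.\<close>

definition selective_identification_function ::
  "(real^'d) measure set
    \<Rightarrow> ((real^'d \<Rightarrow> real) \<Rightarrow> real^'d \<Rightarrow> real^'d \<Rightarrow> real \<times> real)
    \<Rightarrow> ((real^'d) measure \<Rightarrow> real^'d \<Rightarrow> real) \<Rightarrow> ((real^'d) measure \<Rightarrow> (real^'d) set) \<Rightarrow> bool" where
  "selective_identification_function \<M> V T R \<longleftrightarrow>
     (\<forall>F\<in>\<M>. integrable_score V F) \<and> (\<forall>F\<in>\<M>. \<forall>k\<in>R F. bar V (T F) k F = 0)"

end

theory Submission
  imports Defs
begin

text \<open>The quantile function \<open>\<beta> \<mapsto> - VaR \<beta> \<mu>\<close> pushes the uniform distribution on \<open>(0,1)\<close> forward to
  \<open>\<mu>\<close>. With \<open>q = - VaR \<alpha> \<mu>\<close>, the function \<open>x \<mapsto> (x - q) 1{x \<le> q}\<close> composed with the quantile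
  function vanishes on \<open>(\<alpha>,1)\<close> and equals \<open>- VaR \<beta> \<mu> - q\<close> on \<open>(0,\<alpha>]\<close>, so that its integral under
  \<open>\<mu>\<close> is \<open>- \<alpha> (ES \<alpha> \<mu> + q)\<close>. Hence the expectation of \<open>U\<^sub>2\<close> at the true \<open>VaR\<close> is exactly \<open>- ES\<close>, and
  the orientation is a matter of signs. If the distribution function is continuous, it takes the
  value \<open>\<alpha>\<close> at \<open>q\<close>, so the expectation of \<open>U\<^sub>1\<close> vanishes for every \<open>k\<close>.\<close>

text \<open>Translation is Borel, and a null set of the translated law has a null preimage under
  \<open>F\<close>; so translation is measurable even between the completed spaces and can be
  composed with \<open>f\<close>.\<close>

lemma measurable_translation_completion:
  fixes F :: "'a::real_normed_vector measure" and f :: "'a \<Rightarrow> 'b::topological_space"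
  assumes sets_F: "sets F = sets borel"
    and f: "f \<in> borel_measurable (completion (distr F borel (\<lambda>y. y + k)))"
  shows "(\<lambda>y. f (y + k)) \<in> borel_measurable (completion F)"
proof -
  let ?N = "distr F borel (\<lambda>y. y + k)"
  have "(\<lambda>y::'a. y + k) \<in> borel_measurable borel"
    by (intro borel_measurable_continuous_onI continuous_intros)
  then have T: "(\<lambda>y. y + k) \<in> measurable F ?N"
    using sets_F by (simp cong: measurable_cong_sets)
  have "distr (completion F) ?N (\<lambda>y. y + k) = distr F ?N (\<lambda>y. y + k)"
    using T by (rule distr_completion)
  also have "\<dots> = ?N"
    by (rule distr_cong) auto
  finally have "(\<lambda>y. y + k) \<in> measurable (completion F) (completion ?N)"
    using T by (intro completion.measurable_completion2 measurable_completion) auto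
  from measurable_comp[OF this f] show ?thesis
    by (simp add: comp_def)
qed

text \<open>A pair is the sum of the images of its components under the two coordinate embeddings,
  which are bounded linear.\<close>

lemma integrable_Pair:
  fixes f :: "'a \<Rightarrow> 'b::{banach, second_countable_topology}"
    and g :: "'a \<Rightarrow> 'c::{banach, second_countable_topology}"
  assumes "integrable M f" "integrable M g"
  shows "integrable M (\<lambda>x. (f x, g x))"
proof -
  have "bounded_linear (\<lambda>x::'b. (x, 0::'c))" "bounded_linear (\<lambda>y::'c. (0::'b, y))"
    by (intro bounded_linear_Pair bounded_linear_ident bounded_linear_zero)+
  then have "integrable M (\<lambda>x. (f x, 0::'c))" "integrable M (\<lambda>x. (0::'b, g x))"
    using integrable_bounded_linear[OF _ assms(1)] integrable_bounded_linear[OF _ assms(2)]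
    by blast+
  then have "integrable M (\<lambda>x. (f x, 0) + (0, g x))"
    by (rule Bochner_Integration.integrable_add)
  then show ?thesis
    by simp
qed

section \<open>Laws on the line, through the quantile function \<open>I\<close> of the distribution
  function \<open>C\<close>\<close>

context cdf_distribution
begin

lemma VaR_eq: "VaR \<beta> M = - I \<beta>"
  by (simp add: VaR_def)

lemma integrable_iff_integrable_quantile:
  fixes g :: "real \<Rightarrow> real"
  assumes [measurable]: "g \<in> borel_measurable borel"
  shows "integrable M g \<longleftrightarrow> set_integrable lborel {0<..<1} (\<lambda>\<beta>. g (I \<beta>))"
proof -
  have "integrable (distr (restrict_space lborel {0<..<1::real}) borel I) g
      \<longleftrightarrow> integrable (restrict_space lborel {0<..<1}) (\<lambda>\<beta>. g (I \<beta>))"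
    by (intro integrable_distr_eq) auto
  then show ?thesis
    by (simp add: distr_I_eq_M set_integrable_def integrable_restrict_space)
qed

lemma integral_eq_integral_quantile:
  fixes g :: "real \<Rightarrow> real"
  assumes [measurable]: "g \<in> borel_measurable borel"
  shows "(\<integral>x. g x \<partial>M) = (LINT \<beta>:{0<..<1}|lborel. g (I \<beta>))"
proof -
  have "integral\<^sup>L (distr (restrict_space lborel {0<..<1::real}) borel I) g
      = integral\<^sup>L (restrict_space lborel {0<..<1}) (\<lambda>\<beta>. g (I \<beta>))"
    by (intro integral_distr) auto
  then show ?thesis
    by (simp add: distr_I_eq_M set_lebesgue_integral_def integral_restrict_space)
qed

text \<open>Outside the open unit interval \<open>I\<close> may be an infimum of a set that is empty
  or unbounded below, so its values there are replaced by 0.\<close>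

lemma measurable_quantile:
  "(\<lambda>\<beta>. indicator {0<..<1} \<beta> * I \<beta>) \<in> borel_measurable borel"
  using measurable_CI by (subst (asm) borel_measurable_restrict_space_iff) auto

lemma ES_real_valued_iff:
  assumes "0 < \<alpha>" "\<alpha> < 1"
  shows "ES_real_valued \<alpha> M \<longleftrightarrow> set_integrable lborel {0<..<\<alpha>} I"
  using assms
  by (simp add: ES_real_valued_def interval_lebesgue_integrable_def VaR_eq set_integrable_def)

text \<open>For levels below \<alpha> the quantile function is integrable by the assumption on ES;
  for levels from \<alpha> on, monotonicity and the truncation keep it between
  \<open>I \<alpha>\<close> and \<open>c\<close>. The threshold \<open>c\<close> is arbitrary
  because integrability of the score is required for every \<open>v\<close>.\<close>

lemma integrable_truncated:
  assumes \<alpha>: "0 < \<alpha>" "\<alpha> < 1" and ES: "ES_real_valued \<alpha> M"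
  shows "integrable M (\<lambda>x. of_bool (x \<le> c) * x)"
proof -
  let ?Q = "\<lambda>\<beta>. indicator {0<..<1} \<beta> * I \<beta> :: real"
  let ?b = "\<lambda>\<beta>. \<bar>indicator {0<..<\<alpha>} \<beta> * I \<beta>\<bar> + (\<bar>I \<alpha>\<bar> + \<bar>c\<bar>) * indicator {0<..<1} \<beta> :: real"
  have "integrable lborel (\<lambda>\<beta>. indicator {0<..<1} \<beta> * (of_bool (?Q \<beta> \<le> c) * ?Q \<beta>))"
  proof (rule Bochner_Integration.integrable_bound)
    show "integrable lborel ?b"
      using ES \<alpha> by (auto simp: ES_real_valued_iff set_integrable_def)
    show "(\<lambda>\<beta>. indicator {0<..<1} \<beta> * (of_bool (?Q \<beta> \<le> c) * ?Q \<beta>)) \<in> borel_measurable lborel"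
      using measurable_quantile by measurable
    have "\<bar>I \<beta>\<bar> \<le> \<bar>I \<alpha>\<bar> + \<bar>c\<bar>" if "\<alpha> \<le> \<beta>" "\<beta> < 1" "I \<beta> \<le> c" for \<beta>
      using mono_onD[OF mono_I, of \<alpha> \<beta>] that \<alpha> by auto
    then show "AE \<beta> in lborel. norm (indicator {0<..<1} \<beta> * (of_bool (?Q \<beta> \<le> c) * ?Q \<beta>))
        \<le> norm (?b \<beta>)"
      using \<alpha> by (intro AE_I2) (auto simp: indicator_def)
  qed
  also have "(\<lambda>\<beta>. indicator {0<..<1} \<beta> * (of_bool (?Q \<beta> \<le> c) * ?Q \<beta>))
      = (\<lambda>\<beta>. indicator {0<..<1} \<beta> * (of_bool (I \<beta> \<le> c) * I \<beta>))"
    by (auto simp: indicator_def)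
  finally show ?thesis
    by (subst integrable_iff_integrable_quantile) (simp_all add: set_integrable_def)
qed

lemma integral_below_quantile:
  assumes \<alpha>: "0 < \<alpha>" "\<alpha> < 1" and ES: "ES_real_valued \<alpha> M"
  shows "(\<integral>x. of_bool (x \<le> I \<alpha>) * (x - I \<alpha>) \<partial>M) = - \<alpha> * (ES \<alpha> M + I \<alpha>)"
proof -
  have "(\<integral>x. of_bool (x \<le> I \<alpha>) * (x - I \<alpha>) \<partial>M)
      = (LINT \<beta>:{0<..<1}|lborel. of_bool (I \<beta> \<le> I \<alpha>) * (I \<beta> - I \<alpha>))"
    by (intro integral_eq_integral_quantile) measurable
  also have "\<dots> = (LINT \<beta>:{0<..<\<alpha>}|lborel. I \<beta> - I \<alpha>)"
    unfolding set_lebesgue_integral_def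
  proof (intro Bochner_Integration.integral_cong refl)
    fix \<beta> :: real
    \<comment> \<open>If \<open>M\<close> has an atom at \<open>I \<alpha>\<close>, levels
      \<open>\<beta> > \<alpha>\<close> with \<open>I \<beta> = I \<alpha>\<close> can pass the
      indicator, but then the factor \<open>I \<beta> - I \<alpha>\<close> is 0.\<close>
    show "indicator {0<..<1} \<beta> *\<^sub>R (of_bool (I \<beta> \<le> I \<alpha>) * (I \<beta> - I \<alpha>))
        = indicator {0<..<\<alpha>} \<beta> *\<^sub>R (I \<beta> - I \<alpha>)"
      using mono_onD[OF mono_I, of \<alpha> \<beta>] mono_onD[OF mono_I, of \<beta> \<alpha>] \<alpha>
      by (cases "\<beta> < \<alpha>") (auto simp: indicator_def)
  qed
  also have "\<dots> = (LINT \<beta>:{0<..<\<alpha>}|lborel. I \<beta>) - (LINT \<beta>:{0<..<\<alpha>}|lborel. I \<alpha>)"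
    using ES \<alpha> by (intro set_integral_diff) (auto simp: ES_real_valued_iff set_integrable_def)
  also have "(LINT \<beta>:{0<..<\<alpha>}|lborel. I \<alpha>) = \<alpha> * I \<alpha>"
    using \<alpha> by (simp add: set_lebesgue_integral_def)
  also have "(LINT \<beta>:{0<..<\<alpha>}|lborel. I \<beta>) = - \<alpha> * ES \<alpha> M"
    using \<alpha> by (simp add: ES_def interval_lebesgue_integral_def VaR_eq set_lebesgue_integral_def)
  finally show ?thesis
    by (simp add: algebra_simps)
qed

lemma integral_identification_ES:
  assumes \<alpha>: "0 < \<alpha>" "\<alpha> < 1" and ES: "ES_real_valued \<alpha> M"
  shows "(\<integral>x. 1 / \<alpha> * of_bool (x \<le> - VaR \<alpha> M) * x
      + 1 / \<alpha> * (of_bool (x \<le> - VaR \<alpha> M) - \<alpha>) * VaR \<alpha> M \<partial>M) = - ES \<alpha> M"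
    (is "?l = _")
proof -
  have "integrable M (\<lambda>x. of_bool (x \<le> I \<alpha>) * I \<alpha>)"
    by (intro integrable_const_bound[where B="\<bar>I \<alpha>\<bar>"]) auto
  then have int: "integrable M (\<lambda>x. of_bool (x \<le> I \<alpha>) * (x - I \<alpha>))"
    using integrable_truncated[OF assms, of "I \<alpha>"] by (simp add: right_diff_distrib)
  \<comment> \<open>Put \<open>VaR \<alpha> M = - I \<alpha>\<close> and collect the indicator
    terms; the part without an indicator is the constant \<open>I \<alpha>\<close>.\<close>
  have "?l = (\<integral>x. 1 / \<alpha> * (of_bool (x \<le> I \<alpha>) * (x - I \<alpha>)) + I \<alpha> \<partial>M)"
    using \<alpha> by (intro Bochner_Integration.integral_cong refl) (simp add: VaR_eq field_simps)
  also have "\<dots> = 1 / \<alpha> * (\<integral>x. of_bool (x \<le> I \<alpha>) * (x - I \<alpha>) \<partial>M) + I \<alpha>"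
    using int prob_space by simp
  also have "\<dots> = - ES \<alpha> M"
    using \<alpha> by (simp add: integral_below_quantile[OF assms])
  finally show ?thesis .
qed

text \<open>To the left of the quantile the distribution function stays below \<alpha>, so it could
  exceed \<alpha> at the quantile only by a jump, which continuity excludes.\<close>

lemma cdf_VaR:
  assumes \<alpha>: "0 < \<alpha>" "\<alpha> < 1" and cont: "continuous_on UNIV C"
  shows "C (- VaR \<alpha> M) = \<alpha>"
proof (rule antisym)
  \<comment> \<open>\<open>pseudoinverse\<close> is the Galois connection between
    \<open>\<alpha> \<le> C x\<close> and \<open>I \<alpha> \<le> x\<close>; here
    \<open>x = I \<alpha>\<close>, and below it is used for \<open>x < I \<alpha>\<close>.\<close>
  show "\<alpha> \<le> C (- VaR \<alpha> M)"
    using pseudoinverse[OF \<alpha>, of "I \<alpha>"] by (simp add: VaR_eq)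
  have "isCont C (I \<alpha>)"
    using cont by (simp add: continuous_on_eq_continuous_at)
  then have "(C \<longlongrightarrow> C (I \<alpha>)) (at_left (I \<alpha>))"
    by (simp add: isCont_def filterlim_at_split)
  moreover have "eventually (\<lambda>x. C x \<le> \<alpha>) (at_left (I \<alpha>))"
  proof (rule eventually_at_leftI)
    fix x assume "x \<in> {I \<alpha> - 1<..<I \<alpha>}"
    then show "C x \<le> \<alpha>"
      using pseudoinverse[OF \<alpha>, of x] by auto
  qed auto
  ultimately show "C (- VaR \<alpha> M) \<le> \<alpha>"
    by (auto simp: VaR_eq intro: tendsto_upperbound)
qed

end

section \<open>Expectations of the scores, transported to the law of the aggregate\<close>

lemma cdf_distribution_agg_law:
  assumes "prob_space F" "(\<lambda>y. \<Lambda> (y + k)) \<in> borel_measurable (completion F)"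
  shows "cdf_distribution (agg_law \<Lambda> k F)"
proof -
  interpret prob_space "completion F"
    using assms(1) by (auto intro!: prob_spaceI simp: prob_space.emeasure_space_1)
  have "prob_space (agg_law \<Lambda> k F)"
    unfolding agg_law_def using assms(2) by (rule prob_space_distr)
  then show ?thesis
    by (auto simp: cdf_distribution_def real_distribution_def real_distribution_axioms_def
        agg_law_def)
qed

lemma integrable_U2:
  assumes "prob_space F" and X: "(\<lambda>y. \<Lambda> (y + k)) \<in> borel_measurable (completion F)"
    and "0 < \<alpha>" "\<alpha> < 1" "ES_real_valued \<alpha> (agg_law \<Lambda> k F)"
  shows "integrable (completion F) (U2 \<alpha> \<Lambda> v k)"
proof -
  interpret cdf_distribution "agg_law \<Lambda> k F"
    using assms by (intro cdf_distribution_agg_law)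
  have "integrable (agg_law \<Lambda> k F) (\<lambda>x. of_bool (x \<le> - v k) * v k)"
    by (intro integrable_const_bound[where B="\<bar>v k\<bar>"]) auto
  then have "integrable (agg_law \<Lambda> k F) (\<lambda>x. 1 / \<alpha> * (of_bool (x \<le> - v k) * x)
      + 1 / \<alpha> * (of_bool (x \<le> - v k) * v k - \<alpha> * v k))"
    using integrable_truncated[of \<alpha> "- v k"] assms(3-) by simp
  from integrable_distr[OF X this[unfolded agg_law_def]] show ?thesis
    using \<open>0 < \<alpha>\<close> by (simp add: U2_def[abs_def] algebra_simps)
qed

text \<open>The score depends on \<open>y\<close> only through \<open>\<Lambda> (y + k)\<close>, so
  a change of variables to \<open>agg_law\<close> reduces the claim to
  \<open>integral_identification_ES\<close>.\<close>

lemma bar_U2_T_VaR: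
  assumes "prob_space F" and X: "(\<lambda>y. \<Lambda> (y + k)) \<in> borel_measurable (completion F)"
    and "0 < \<alpha>" "\<alpha> < 1" "ES_real_valued \<alpha> (agg_law \<Lambda> k F)"
  shows "bar (U2 \<alpha> \<Lambda>) (T_VaR \<alpha> \<Lambda> F) k F = - ES \<alpha> (agg_law \<Lambda> k F)"
proof -
  interpret cdf_distribution "agg_law \<Lambda> k F"
    using assms by (intro cdf_distribution_agg_law)
  let ?g = "\<lambda>a x. 1 / \<alpha> * of_bool (x \<le> - a) * x + 1 / \<alpha> * (of_bool (x \<le> - a) - \<alpha>) * a :: real"
  have "bar (U2 \<alpha> \<Lambda>) (T_VaR \<alpha> \<Lambda> F) k F
      = (\<integral>y. ?g (VaR \<alpha> (agg_law \<Lambda> k F)) (\<Lambda> (y + k)) \<partial>completion F)"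
    by (simp add: bar_def U2_def T_VaR_def)
  also have "\<dots> = (\<integral>x. ?g (VaR \<alpha> (agg_law \<Lambda> k F)) x \<partial>agg_law \<Lambda> k F)"
    unfolding agg_law_def[of \<Lambda> k F] using X by (intro integral_distr[symmetric]) auto
  also have "\<dots> = - ES \<alpha> (agg_law \<Lambda> k F)"
    using assms(3-) by (rule integral_identification_ES)
  finally show ?thesis .
qed

lemma integrable_U1:
  assumes "prob_space F" and X[measurable]: "(\<lambda>y. \<Lambda> (y + k)) \<in> borel_measurable (completion F)"
  shows "integrable (completion F) (U1 \<alpha> \<Lambda> v k)"
proof -
  interpret prob_space "completion F"
    using assms(1) by (auto intro!: prob_spaceI simp: prob_space.emeasure_space_1)
  show ?thesis
    unfolding U1_def[abs_def] by (intro integrable_const_bound[where B="\<bar>\<alpha>\<bar> + 1"]) auto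
qed

text \<open>After the same change of variables the expectation is \<alpha> minus the distribution
  function at its own \<alpha>-quantile, which \<open>cdf_VaR\<close> evaluates.\<close>

lemma bar_U1_T_VaR:
  assumes "prob_space F" and X: "(\<lambda>y. \<Lambda> (y + k)) \<in> borel_measurable (completion F)"
    and "0 < \<alpha>" "\<alpha> < 1" "continuous_on UNIV (cdf (agg_law \<Lambda> k F))"
  shows "bar (U1 \<alpha> \<Lambda>) (T_VaR \<alpha> \<Lambda> F) k F = 0"
proof -
  interpret cdf_distribution "agg_law \<Lambda> k F"
    using assms by (intro cdf_distribution_agg_law)
  let ?q = "- VaR \<alpha> (agg_law \<Lambda> k F)"
  have "bar (U1 \<alpha> \<Lambda>) (T_VaR \<alpha> \<Lambda> F) k F = (\<integral>y. \<alpha> - indicator {..?q} (\<Lambda> (y + k)) \<partial>completion F)"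
    unfolding bar_def U1_def T_VaR_def
    by (intro Bochner_Integration.integral_cong) (auto simp: indicator_def)
  also have "\<dots> = (\<integral>x. \<alpha> - indicator {..?q} x \<partial>agg_law \<Lambda> k F)"
    unfolding agg_law_def[of \<Lambda> k F] using X by (intro integral_distr[symmetric]) auto
  also have "\<dots> = \<alpha> - cdf (agg_law \<Lambda> k F) ?q"
    using prob_space by (simp add: cdf_def emeasure_eq_measure)
  also have "\<dots> = 0"
    using cdf_VaR assms(3-) by simp
  finally show ?thesis .
qed

theorem proposition5p1:
  fixes M :: "'w measure"
    and \<Y>d :: "('w \<Rightarrow> real^'d) set"
    and \<Y> :: "('w \<Rightarrow> real) set"
    and \<Lambda> :: "real^'d \<Rightarrow> real"
    and \<alpha> :: real
  assumes "prob_space M" and "atomless M"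
    and "\<Y>d \<subseteq> borel_measurable M"
    and "\<And>Y k. Y \<in> \<Y>d \<Longrightarrow> (\<lambda>\<omega>. Y \<omega> + k) \<in> \<Y>d"
    and "mono \<Lambda>"
    and "\<And>F. F \<in> laws M \<Y>d \<Longrightarrow> \<Lambda> \<in> borel_measurable (completion F)"
    and "\<Y> \<subseteq> borel_measurable M"
    and "\<And>Y. Y \<in> \<Y>d \<Longrightarrow> (\<lambda>\<omega>. \<Lambda> (Y \<omega>)) \<in> \<Y>"
    and "0 < \<alpha>" and "\<alpha> < 1"
    and "\<And>\<mu>. \<mu> \<in> laws M \<Y> \<Longrightarrow> ES_real_valued \<alpha> \<mu>"
  shows "(\<forall>F \<in> laws M \<Y>d.
           integrable_score (U2 \<alpha> \<Lambda>) F \<and>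
           (\<forall>k. (k \<notin> R_ES \<alpha> \<Lambda> F \<longrightarrow> bar (U2 \<alpha> \<Lambda>) (T_VaR \<alpha> \<Lambda> F) k F < 0) \<and>
                (k \<in> R0_ES \<alpha> \<Lambda> F \<longrightarrow> bar (U2 \<alpha> \<Lambda>) (T_VaR \<alpha> \<Lambda> F) k F = 0) \<and>
                (k \<in> R_ES \<alpha> \<Lambda> F - R0_ES \<alpha> \<Lambda> F \<longrightarrow> bar (U2 \<alpha> \<Lambda>) (T_VaR \<alpha> \<Lambda> F) k F > 0))) \<and>
         ((\<forall>\<mu> \<in> laws M \<Y>. continuous_on UNIV (cdf \<mu>) \<and> strict_mono (cdf \<mu>)) \<longrightarrow>
           selective_identification_function (laws M \<Y>d) (U \<alpha> \<Lambda>) (T_VaR \<alpha> \<Lambda>) (R0_ES \<alpha> \<Lambda>))"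
proof -
  have law: "prob_space F" "(\<lambda>y. \<Lambda> (y + k)) \<in> borel_measurable (completion F)"
      "agg_law \<Lambda> k F \<in> laws M \<Y>" if "F \<in> laws M \<Y>d" for F k
  proof -
    from that obtain Y where Y: "Y \<in> \<Y>d" and F: "F = distr M borel Y"
      by (auto simp: laws_def)
    have Y_meas: "Y \<in> borel_measurable M"
      using Y assms(3) by auto
    show "prob_space F"
      unfolding F using assms(1) Y_meas by (rule prob_space.prob_space_distr)
    have Yk: "(\<lambda>\<omega>. Y \<omega> + k) \<in> \<Y>d"
      using Y by (rule assms(4))
    \<comment> \<open>Measurability is assumed for \<Lambda> itself, not for its translates. The
      translate of \<open>F\<close> is the law of \<open>Y + k\<close>, again in the class, so the
      assumption applies to it and is pulled back to \<open>F\<close>.\<close>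
    have "distr F borel (\<lambda>y. y + k) = distr M borel (\<lambda>\<omega>. Y \<omega> + k)"
      unfolding F using Y_meas by (subst distr_distr) (auto simp: comp_def)
    also have "\<dots> \<in> laws M \<Y>d"
      using Yk by (auto simp: laws_def)
    finally show X: "(\<lambda>y. \<Lambda> (y + k)) \<in> borel_measurable (completion F)"
      by (intro measurable_translation_completion assms(6)) (auto simp: F)
    have \<Lambda>Y: "(\<lambda>\<omega>. \<Lambda> (Y \<omega> + k)) \<in> \<Y>"
      using Yk by (rule assms(8))
    then have "agg_law \<Lambda> k F = distr M borel (\<lambda>\<omega>. \<Lambda> (Y \<omega> + k))"
      using X assms(7) unfolding F by (intro agg_law_distr Y_meas) auto
    then show "agg_law \<Lambda> k F \<in> laws M \<Y>"
      using \<Lambda>Y by (auto simp: laws_def)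
  qed
  \<comment> \<open>Each fact of \<open>law\<close> brings its own premise on \<open>F\<close>, so
    these instances carry that premise three times.\<close>
  note U2 = integrable_U2[OF law(1,2) assms(9,10) assms(11)[OF law(3)]]
    bar_U2_T_VaR[OF law(1,2) assms(9,10) assms(11)[OF law(3)]]
  have "selective_identification_function (laws M \<Y>d) (U \<alpha> \<Lambda>) (T_VaR \<alpha> \<Lambda>) (R0_ES \<alpha> \<Lambda>)"
    if cont: "\<And>\<mu>. \<mu> \<in> laws M \<Y> \<Longrightarrow> continuous_on UNIV (cdf \<mu>)"
    unfolding selective_identification_function_def
  proof (intro conjI ballI)
    fix F assume F: "F \<in> laws M \<Y>d"
    have int: "integrable (completion F) (U \<alpha> \<Lambda> v k)" for v k
      unfolding U_def[abs_def] using F by (intro integrable_Pair integrable_U1 law U2)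
    then show "integrable_score (U \<alpha> \<Lambda>) F"
      by (simp add: integrable_score_def)
    fix k assume k: "k \<in> R0_ES \<alpha> \<Lambda> F"
    let ?T = "T_VaR \<alpha> \<Lambda> F"
    \<comment> \<open>Taking the integral of the pair componentwise relies on
      \<open>int\<close>.\<close>
    have "fst (bar (U \<alpha> \<Lambda>) ?T k F) = bar (U1 \<alpha> \<Lambda>) ?T k F"
      using integral_fst[OF int] by (simp add: bar_def arg_cong[OF U_def, of fst])
    also have "\<dots> = 0"
      using F by (intro bar_U1_T_VaR law cont assms(9,10))
    finally have 1: "fst (bar (U \<alpha> \<Lambda>) ?T k F) = 0" .
    have "snd (bar (U \<alpha> \<Lambda>) ?T k F) = bar (U2 \<alpha> \<Lambda>) ?T k F"
      using integral_snd[OF int] by (simp add: bar_def arg_cong[OF U_def, of snd])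
    also have "\<dots> = 0"
      using k by (simp add: U2(2)[OF F F F] R0_ES_def)
    finally show "bar (U \<alpha> \<Lambda>) ?T k F = 0"
      using 1 by (simp add: prod_eq_iff)
  qed
  moreover have "integrable_score (U2 \<alpha> \<Lambda>) F" if "F \<in> laws M \<Y>d" for F
    using U2(1) that by (simp add: integrable_score_def)
  ultimately show ?thesis
    \<comment> \<open>The expectation is minus ES, so the three cases of the orientation are ES
      positive, zero and negative.\<close>
    by (auto simp: U2(2) R_ES_def R0_ES_def)
qed

end
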